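(* Let $\varepsilon\in(0,1)$ and let $\alpha\ge\max_{t\le T}\alpha(G^t)$, where $\alpha(G)$ is the independence number of $G$. Let $\mathcal{A}$ be a full information algorithm such that, for every $L>0$, when run on any sequence of losses in $[0,L]$, its expected $(\varepsilon/2)$-approximate regret against any arm $f\in[d]$ satisfies $\mathbb{E}[\mathrm{ApxReg}(f,\varepsilon/2)]\le \frac{2L\cdot A(d,T)}{\varepsilon}$. Then, in the graph-feedback online learning protocol, the Double-Threshold Freezing Algorithm run with learning parameter $\varepsilon'=\varepsilon/2$ on input $\mathcal{A},\alpha,d$ satisfies, for every arm $f\in[d]$, $$\mathbb{E}\big[\mathrm{ApxReg}(f,\varepsilon)\big]\le \frac{48\,\alpha\, A(d,T)}{\varepsilon^2}.$$
   Context: **Protocol.** There are $d$ arms and $T$ rounds. In each round $t$ an undirected graph $G^t$ on vertex set $[d]$ is revealed to the learner; the learner picks a distribution $w^t$ on $[d]$; the adversary picks a loss vector $\ell^t\in[0,1]^d$ (graphs and losses may depend on the past, in particular on $I(1),\dots,I(t-1)$, but not on $I(t)$); the learner draws $I(t)\sim w^t$, suffers $\ell^t_{I(t)}$, and observes $\ell^t_j$ for all $j\in N^t_{I(t)}$, where $N^t_i$ consists of $i$ and its neighbours in $G^t$. **Approximate regret.** $\mathrm{ApxReg}(f,\varepsilon)=(1-\varepsilon)\sum_{t=1}^T\ell^t_{I(t)}-\sum_{t=1}^T\ell^t_f$. **Full information algorithm.** It outputs in each round $t$ a distribution $p^t$ on $[d]$ as a function of the past full loss vectors $\widetilde\ell^1,\dots,\widetilde\ell^{t-1}$;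 its expected $\varepsilon$-approximate regret against $f$ is $(1-\varepsilon)\sum_t\sum_i p_i^t\widetilde\ell_i^t-\sum_t\widetilde\ell^t_f$. $A(d,T)\ge 0$ is a quantity depending on $d,T$ only. **Double-Threshold Freezing Algorithm** (inputs $\mathcal{A},\alpha,d$, learning parameter $\varepsilon'$; thresholds $\gamma=\frac{\varepsilon'}{4\alpha}$, $\gamma'=\gamma/3$). In each round $t$, with $p^t$ the distribution given by $\mathcal{A}$: (1) $F_0^t=\{i:\sum_{j\in N_i^t}p_j^t<\gamma\}$; (2) for $k\ge1$, $F_k^t=\{i\notin\bigcup_{m<k}F_m^t:\ \sum_{j\in N_i^t\setminus\bigcup_{m<k}F_m^t}p_j^t<\gamma'\}$, and $F^t=\bigcup_{k\ge0}F_k^t$ (frozen arms); (3) $w_i^t=0$ for $i\in F^t$ and $w_i^t=p_i^t/(1-\sum_{j\in F^t}p_j^t)$ otherwise; (4) draw $I(t)\sim w^t$; (5) set $\widetilde\ell_i^t=\ell_i^t/W_i^t$ with $W_i^t=\sum_{j\in N_i^t}w_j^t$ if $i\in N^t_{I(t)}\setminus F^t$, and $\widetilde\ell_i^t=0$ otherwise; (6) feed $\widetilde\ell^t$ to $\mathcal{A}$ as the round-$t$ loss vector to obtain $p^{t+1}$. *)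

theory Defs
  imports "HOL-Probability.Probability"
begin

text \<open>An undirected graph on the arms is given by its adjacency relation.\<close>

definition undirected_graph :: "'arm rel \<Rightarrow> bool" where
  "undirected_graph G \<longleftrightarrow> sym G \<and> irrefl G"

definition independent_set :: "'arm rel \<Rightarrow> 'arm set \<Rightarrow> bool" where
  "independent_set G S \<longleftrightarrow> (\<forall>i\<in>S. \<forall>j\<in>S. (i, j) \<notin> G)"

definition independence_number :: "'arm::finite rel \<Rightarrow> nat" where
  "independence_number G = Max (card ` {S. independent_set G S})"

definition closed_nbhd :: "'arm rel \<Rightarrow> 'arm \<Rightarrow> 'arm set" where
  "closed_nbhd G i = insert i (G `` {i})"

text \<open>
  Rounds are numbered \<open>1, \<dots>, T\<close>. The argument \<open>c\<close> is the loss incurred by the learner in each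
  round: the loss of the drawn arm in the graph-feedback protocol, and the mean loss under the
  chosen distribution in the full information setting.
\<close>

definition apx_regret ::
  "nat \<Rightarrow> (nat \<Rightarrow> real) \<Rightarrow> (nat \<Rightarrow> 'arm \<Rightarrow> real) \<Rightarrow> 'arm \<Rightarrow> real \<Rightarrow> real" where
  "apx_regret T c l f \<epsilon> = (1 - \<epsilon>) * (\<Sum>t=1..T. c t) - (\<Sum>t=1..T. l t f)"

text \<open>
  A full information algorithm maps the list of past loss vectors, oldest first, to a
  distribution on the arms.
\<close>

type_synonym 'arm full_info_alg = "('arm \<Rightarrow> real) list \<Rightarrow> 'arm pmf"

definition full_info_apx_regret ::
  "'arm::finite full_info_alg \<Rightarrow> nat \<Rightarrow> (nat \<Rightarrow> 'arm \<Rightarrow> real) \<Rightarrow> 'arm \<Rightarrow> real \<Rightarrow> real" where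
  "full_info_apx_regret \<A> T l f \<epsilon> =
     apx_regret T (\<lambda>t. \<Sum>i\<in>UNIV. pmf (\<A> (map l [1..<t])) i * l t i) l f \<epsilon>"

text \<open>
  The protocol allows a randomised adaptive adversary: \<open>F t\<close> is the information available just
  before the draw of \<open>I t\<close>, comprising at least the previous draws, the current graph and the
  current loss vector. Given \<open>F t\<close>, the arm \<open>I t\<close> has distribution \<open>w t\<close>. In particular \<open>w t\<close>
  agrees almost everywhere with an \<open>F t\<close>-measurable function, so that no measurability
  assumption on the learner is needed.
\<close>

locale graph_feedback_protocol = prob_space M + filtration "space M" F
  for M :: "'\<omega> measure" and F :: "nat \<Rightarrow> '\<omega> measure" +
  fixes T :: nat
    and G :: "nat \<Rightarrow> '\<omega> \<Rightarrow> 'arm::finite rel"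
    and w :: "nat \<Rightarrow> '\<omega> \<Rightarrow> 'arm \<Rightarrow> real"
    and l :: "nat \<Rightarrow> '\<omega> \<Rightarrow> 'arm \<Rightarrow> real"
    and I :: "nat \<Rightarrow> '\<omega> \<Rightarrow> 'arm"
  assumes subalg: "\<And>t. subalgebra M (F t)"
    and graph: "\<And>t \<omega>. t \<in> {1..T} \<Longrightarrow> \<omega> \<in> space M \<Longrightarrow> undirected_graph (G t \<omega>)"
    and graph_measurable: "\<And>t. t \<in> {1..T} \<Longrightarrow> G t \<in> F t \<rightarrow>\<^sub>M count_space UNIV"
    and loss: "\<And>t \<omega> i. t \<in> {1..T} \<Longrightarrow> \<omega> \<in> space M \<Longrightarrow> l t \<omega> i \<in> {0..1}"
    and loss_measurable: "\<And>t i. t \<in> {1..T} \<Longrightarrow> (\<lambda>\<omega>. l t \<omega> i) \<in> borel_measurable (F t)"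
    and draw_measurable: "\<And>t. t \<in> {1..T} \<Longrightarrow> I t \<in> M \<rightarrow>\<^sub>M count_space UNIV"
    and past_draws_measurable:
      "\<And>s t. 1 \<le> s \<Longrightarrow> s < t \<Longrightarrow> t \<le> T \<Longrightarrow> I s \<in> F t \<rightarrow>\<^sub>M count_space UNIV"
    and draw_distribution:
      "\<And>t i. t \<in> {1..T} \<Longrightarrow>
         AE \<omega> in M. real_cond_exp M (F t) (indicator {\<omega> \<in> space M. I t \<omega> = i}) \<omega> = w t \<omega> i"

text \<open>
  One round of the Double-Threshold Freezing Algorithm, for the graph \<open>G\<close> and the distribution
  \<open>p\<close> of the full information algorithm in that round.
\<close>

definition threshold :: "real \<Rightarrow> real \<Rightarrow> real" where
  "threshold \<alpha> \<epsilon> = \<epsilon> / (4 * \<alpha>)"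

fun frozen_level ::
  "real \<Rightarrow> real \<Rightarrow> 'arm::finite rel \<Rightarrow> ('arm \<Rightarrow> real) \<Rightarrow> nat \<Rightarrow> 'arm set" where
  "frozen_level \<alpha> \<epsilon> G p k =
     (if k = 0 then {i. (\<Sum>j\<in>closed_nbhd G i. p j) < threshold \<alpha> \<epsilon>}
      else {i. i \<notin> (\<Union>m\<in>{..<k}. frozen_level \<alpha> \<epsilon> G p m) \<and>
               (\<Sum>j\<in>closed_nbhd G i - (\<Union>m\<in>{..<k}. frozen_level \<alpha> \<epsilon> G p m). p j)
                 < threshold \<alpha> \<epsilon> / 3})"

declare frozen_level.simps [simp del]

definition frozen :: "real \<Rightarrow> real \<Rightarrow> 'arm::finite rel \<Rightarrow> ('arm \<Rightarrow> real) \<Rightarrow> 'arm set" where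
  "frozen \<alpha> \<epsilon> G p = (\<Union>k. frozen_level \<alpha> \<epsilon> G p k)"

definition dtf_weight ::
  "real \<Rightarrow> real \<Rightarrow> 'arm::finite rel \<Rightarrow> ('arm \<Rightarrow> real) \<Rightarrow> 'arm \<Rightarrow> real" where
  "dtf_weight \<alpha> \<epsilon> G p i =
     (if i \<in> frozen \<alpha> \<epsilon> G p then 0 else p i / (1 - (\<Sum>j\<in>frozen \<alpha> \<epsilon> G p. p j)))"

definition dtf_estimate ::
  "real \<Rightarrow> real \<Rightarrow> 'arm::finite rel \<Rightarrow> ('arm \<Rightarrow> real) \<Rightarrow> ('arm \<Rightarrow> real) \<Rightarrow> 'arm \<Rightarrow> 'arm \<Rightarrow> real" where
  "dtf_estimate \<alpha> \<epsilon> G p l a i =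
     (if i \<in> closed_nbhd G a - frozen \<alpha> \<epsilon> G p
      then l i / (\<Sum>j\<in>closed_nbhd G i. dtf_weight \<alpha> \<epsilon> G p j) else 0)"

text \<open>
  The run of the algorithm along a fixed sequence of graphs, losses and draws:
  \<open>dtf_loss \<dots> t\<close> is the loss vector fed to \<open>\<A>\<close> in round \<open>t\<close>, \<open>dtf_full_info \<dots> t\<close> is the
  distribution of \<open>\<A>\<close> in round \<open>t\<close>, and \<open>dtf_play \<dots> t\<close> is the distribution from which the arm
  of round \<open>t\<close> is drawn. The last two depend at most on rounds before \<open>t\<close> and on
  \<open>G t\<close>.
\<close>

fun dtf_loss ::
  "'arm::finite full_info_alg \<Rightarrow> real \<Rightarrow> real \<Rightarrow> (nat \<Rightarrow> 'arm rel) \<Rightarrow> (nat \<Rightarrow> 'arm \<Rightarrow> real) \<Rightarrow>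
   (nat \<Rightarrow> 'arm) \<Rightarrow> nat \<Rightarrow> 'arm \<Rightarrow> real" where
  "dtf_loss \<A> \<alpha> \<epsilon> G l I t =
     dtf_estimate \<alpha> \<epsilon> (G t) (pmf (\<A> (map (\<lambda>s. dtf_loss \<A> \<alpha> \<epsilon> G l I s) [1..<t]))) (l t) (I t)"

declare dtf_loss.simps [simp del]

definition dtf_full_info ::
  "'arm::finite full_info_alg \<Rightarrow> real \<Rightarrow> real \<Rightarrow> (nat \<Rightarrow> 'arm rel) \<Rightarrow> (nat \<Rightarrow> 'arm \<Rightarrow> real) \<Rightarrow>
   (nat \<Rightarrow> 'arm) \<Rightarrow> nat \<Rightarrow> 'arm pmf" where
  "dtf_full_info \<A> \<alpha> \<epsilon> G l I t = \<A> (map (dtf_loss \<A> \<alpha> \<epsilon> G l I) [1..<t])"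

definition dtf_play ::
  "'arm::finite full_info_alg \<Rightarrow> real \<Rightarrow> real \<Rightarrow> (nat \<Rightarrow> 'arm rel) \<Rightarrow> (nat \<Rightarrow> 'arm \<Rightarrow> real) \<Rightarrow>
   (nat \<Rightarrow> 'arm) \<Rightarrow> nat \<Rightarrow> 'arm \<Rightarrow> real" where
  "dtf_play \<A> \<alpha> \<epsilon> G l I t = dtf_weight \<alpha> \<epsilon> (G t) (pmf (dtf_full_info \<A> \<alpha> \<epsilon> G l I t))"

end

theory Submission imports Defs begin

text \<open>
  Given the past, the estimate of the loss of an arm is unbiased unless the arm is frozen, when it
  is \<open>0\<close>; all estimates are at most \<open>1/\<gamma>' = 24\<alpha>/\<epsilon>\<close>. Hence the regret guarantee of the full
  information algorithm on the estimates transfers to the true losses at the price of a factor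
  \<open>1 - p(F)\<close>, where \<open>p(F)\<close> is the mass of the frozen arms. The first level \<open>F\<^sub>0\<close> is covered by the
  neighbourhoods of at most \<open>\<alpha>\<close> of its arms, so \<open>p(F\<^sub>0) \<le> \<alpha>\<gamma>\<close>, and the ratio \<open>\<gamma>/\<gamma>' = 3\<close> of the
  thresholds bounds the mass of the later levels by \<open>3 p(F\<^sub>0)\<close>; so \<open>p(F) \<le> 4\<alpha>\<gamma> = \<epsilon>/2\<close>, and
  \<open>(1 - \<epsilon>/2)\<^sup>2 \<ge> 1 - \<epsilon>\<close>.
\<close>

section \<open>Independent sets and domination\<close>

lemma undirected_graph_closed_nbhd_sym:
  "undirected_graph G \<Longrightarrow> i \<in> closed_nbhd G j \<longleftrightarrow> j \<in> closed_nbhd G i"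
  by (auto simp: undirected_graph_def closed_nbhd_def dest: symD)

lemma card_independent_set_le:
  fixes G :: "'arm::finite rel"
  shows "independent_set G S \<Longrightarrow> card S \<le> independence_number G"
  unfolding independence_number_def by (rule Max_ge) auto

lemma independence_number_pos:
  fixes G :: "'arm::finite rel"
  assumes "undirected_graph G"
  shows "0 < independence_number G"
proof -
  have "independent_set G {undefined}"
    using assms by (auto simp: independent_set_def undirected_graph_def irrefl_def)
  from card_independent_set_le[OF this] show ?thesis by simp
qed

text \<open>Take a maximal independent subset of \<open>X\<close>: an element of \<open>X\<close>
  outside all its closed neighbourhoods could be added to it.\<close>

lemma dominating_independent_subset:
  fixes G :: "'arm::finite rel"
  assumes "undirected_graph G"
  obtains S where "independent_set G S" "S \<subseteq> X" "X \<subseteq> (\<Union>i\<in>S. closed_nbhd G i)"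
proof -
  define C where "C = {S. independent_set G S \<and> S \<subseteq> X}"
  have "C \<noteq> {}"
    by (auto simp: C_def independent_set_def)
  then obtain S where S: "S \<in> C" and max: "\<forall>S'\<in>C. S \<subseteq> S' \<longrightarrow> S = S'"
    using finite_has_maximal[OF finite[of C]] by auto
  have "x \<in> (\<Union>i\<in>S. closed_nbhd G i)" if "x \<in> X" for x
  proof (rule ccontr)
    assume *: "x \<notin> (\<Union>i\<in>S. closed_nbhd G i)"
    then have "independent_set G (insert x S)"
      using S assms
      by (auto simp: C_def independent_set_def undirected_graph_def closed_nbhd_def irrefl_def
          dest: symD)
    then have "S = insert x S"
      using S that max by (auto simp: C_def)
    then show False
      using * by (auto simp: closed_nbhd_def)
  qed
  then show ?thesis
    using S by (intro that[of S]) (auto simp: C_def)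
qed

section \<open>Frozen mass and observation weights in a single round\<close>

locale freezing_round =
  fixes \<alpha> \<epsilon> :: real and G :: "'arm::finite rel" and p :: "'arm pmf"
  assumes undirected: "undirected_graph G"
    and independence: "real (independence_number G) \<le> \<alpha>"
    and eps_pos: "0 < \<epsilon>" and eps_less_1: "\<epsilon> < 1"
begin

abbreviation "\<gamma> \<equiv> threshold \<alpha> \<epsilon>"
abbreviation "level \<equiv> frozen_level \<alpha> \<epsilon> G (pmf p)"
abbreviation "frozen_arms \<equiv> frozen \<alpha> \<epsilon> G (pmf p)"
abbreviation "weight \<equiv> dtf_weight \<alpha> \<epsilon> G (pmf p)"

lemma alpha_pos: "0 < \<alpha>"
  using independence_number_pos[OF undirected] independence by linarith

lemma gamma_pos: "0 < \<gamma>"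
  using alpha_pos eps_pos by (simp add: threshold_def)

text \<open>By disjointness of the levels, this is the only level of a frozen arm. On unfrozen arms
  the value is arbitrary, hence the guard by \<open>frozen_arms\<close> in
  \<open>Union_level\<close>.\<close>

definition stage :: "'arm \<Rightarrow> nat" where
  "stage i = (LEAST k. i \<in> level k)"

lemma level_0_iff: "i \<in> level 0 \<longleftrightarrow> (\<Sum>j\<in>closed_nbhd G i. pmf p j) < \<gamma>"
  by (subst frozen_level.simps) simp

lemma level_pos_iff:
  "0 < k \<Longrightarrow> i \<in> level k \<longleftrightarrow> i \<notin> (\<Union>m<k. level m) \<and>
    (\<Sum>j\<in>closed_nbhd G i - (\<Union>m<k. level m). pmf p j) < \<gamma> / 3"
  by (subst frozen_level.simps) simp

lemma level_disjoint: "i \<in> level k \<Longrightarrow> m < k \<Longrightarrow> i \<notin> level m"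
  using level_pos_iff[of k i] by auto

lemma stage_eq: "i \<in> level k \<Longrightarrow> stage i = k"
  unfolding stage_def by (rule Least_equality) (auto intro: leI dest: level_disjoint)

lemma level_stage: "i \<in> frozen_arms \<Longrightarrow> i \<in> level (stage i)"
  using stage_eq by (auto simp: frozen_def)

lemma level_subset: "level k \<subseteq> frozen_arms"
  by (auto simp: frozen_def)

lemma Union_level: "(\<Union>m<k. level m) = {i \<in> frozen_arms. stage i < k}"
proof safe
  fix i m
  assume "m < k" "i \<in> level m"
  then show "i \<in> frozen_arms" "stage i < k"
    using level_subset stage_eq by auto
qed (use level_stage in blast)

lemma unfrozen_nbhd_mass:
  assumes "i \<notin> frozen_arms"
  shows "\<gamma> / 3 \<le> (\<Sum>j\<in>closed_nbhd G i - frozen_arms. pmf p j)"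
proof -
  \<comment> \<open>There are finitely many stages, so from some index on the freezing test is made
    against all of \<open>frozen_arms\<close>, and an unfrozen arm fails it. The successor in
    \<open>Suc K\<close> makes \<open>level_pos_iff\<close> applicable.\<close>
  obtain K where "\<forall>k \<in> stage ` frozen_arms. k < K"
    using finite_nat_set_iff_bounded[of "stage ` frozen_arms"] by auto
  then have "(\<Union>m<Suc K. level m) = frozen_arms"
    unfolding Union_level by (auto intro: less_SucI)
  then show ?thesis
    using level_pos_iff[of "Suc K" i] level_subset[of "Suc K"] assms by (auto simp: not_less)
qed

lemma level_0_mass: "(\<Sum>i\<in>level 0. pmf p i) \<le> \<alpha> * \<gamma>"
proof -
  obtain S where S: "independent_set G S" "S \<subseteq> level 0"
      "level 0 \<subseteq> (\<Union>i\<in>S. closed_nbhd G i)"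
    using dominating_independent_subset[OF undirected] by blast
  have "(\<Sum>i\<in>level 0. pmf p i) \<le> (\<Sum>i\<in>(\<Union>i\<in>S. closed_nbhd G i). pmf p i)"
    using S(3) by (intro sum_mono2) auto
  also have "\<dots> \<le> (\<Sum>i\<in>S. \<Sum>j\<in>closed_nbhd G i. pmf p j)"
    using measure_pmf.finite_measure_subadditive_finite[of S "closed_nbhd G" p]
    by (simp add: measure_measure_pmf_finite)
  also have "\<dots> \<le> (\<Sum>i\<in>S. \<gamma>)"
    using S(2) level_0_iff by (intro sum_mono) (auto intro: less_imp_le)
  also have "\<dots> = real (card S) * \<gamma>"
    by simp
  also have "\<dots> \<le> \<alpha> * \<gamma>"
    using card_independent_set_le[OF S(1)] independence gamma_pos
    by (intro mult_right_mono) auto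
  finally show ?thesis .
qed

text \<open>
  Double counting of the \<open>p \<otimes> p\<close>-mass of the edges between frozen arms of different stages: an
  arm of positive stage has neighbours of mass at least \<open>2\<gamma>/3\<close> below it, whereas an arm has
  neighbours of mass at most \<open>\<gamma>\<close> (stage \<open>0\<close>) or \<open>\<gamma>/3\<close> (positive stage) above it.
\<close>

lemma positive_level_mass:
  "(\<Sum>i\<in>frozen_arms - level 0. pmf p i) \<le> 3 * (\<Sum>i\<in>level 0. pmf p i)"
proof -
  let ?H = "frozen_arms - level 0"
  let ?e = "\<lambda>i j. of_bool (j \<in> closed_nbhd G i \<and> stage j < stage i) :: real"
  have stage_pos: "0 < stage i" if "i \<in> ?H" for i
    using that level_stage[of i] by (cases "stage i") auto
  \<comment> \<open>\<open>i\<close> survived the test of stage 0, so its neighbourhood has mass at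
    least \<gamma>; when it was frozen, less than \<gamma>/3 of that lay outside the earlier
    levels.\<close>
  have lower: "2 * \<gamma> / 3 \<le> (\<Sum>j\<in>frozen_arms. pmf p j * ?e i j)" if i: "i \<in> ?H" for i
  proof -
    let ?B = "{j \<in> frozen_arms. stage j < stage i}"
    have "(\<Sum>j\<in>closed_nbhd G i - ?B. pmf p j) < \<gamma> / 3"
      using level_pos_iff[OF stage_pos[OF i]] level_stage[of i] i Union_level by auto
    moreover have "\<gamma> \<le> (\<Sum>j\<in>closed_nbhd G i. pmf p j)"
      using i level_0_iff by (auto simp: not_less)
    moreover have "(\<Sum>j\<in>closed_nbhd G i. pmf p j) =
        (\<Sum>j\<in>closed_nbhd G i - ?B. pmf p j) + (\<Sum>j\<in>closed_nbhd G i \<inter> ?B. pmf p j)"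
      by (subst sum.union_disjoint[symmetric]) (auto intro: sum.cong)
    moreover have "(\<Sum>j\<in>closed_nbhd G i \<inter> ?B. pmf p j) = (\<Sum>j\<in>frozen_arms. pmf p j * ?e i j)"
      by (intro sum.mono_neutral_cong_left) auto
    ultimately show ?thesis by linarith
  qed
  \<comment> \<open>By symmetry of the graph, the later-stage neighbours of \<open>j\<close> lie in
    the set whose mass was tested when \<open>j\<close> itself was frozen.\<close>
  have upper: "(\<Sum>i\<in>?H. pmf p i * ?e i j) \<le> (if j \<in> level 0 then \<gamma> else \<gamma> / 3)"
    if j: "j \<in> frozen_arms" for j
  proof -
    let ?B = "{i \<in> frozen_arms. stage i < stage j}"
    have le: "(\<Sum>i\<in>?H. pmf p i * ?e i j) \<le> (\<Sum>i\<in>closed_nbhd G j - ?B. pmf p i)"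
    proof -
      have "(\<Sum>i\<in>?H. pmf p i * ?e i j) =
          (\<Sum>i\<in>{i \<in> ?H. j \<in> closed_nbhd G i \<and> stage j < stage i}. pmf p i)"
        by (intro sum.mono_neutral_cong_right) auto
      also have "\<dots> \<le> (\<Sum>i\<in>closed_nbhd G j - ?B. pmf p i)"
        using undirected_graph_closed_nbhd_sym[OF undirected] by (intro sum_mono2) auto
      finally show ?thesis .
    qed
    show ?thesis
    proof (cases "j \<in> level 0")
      case True
      have "(\<Sum>i\<in>closed_nbhd G j - ?B. pmf p i) \<le> (\<Sum>i\<in>closed_nbhd G j. pmf p i)"
        by (intro sum_mono2) auto
      then show ?thesis
        using le True level_0_iff[of j] by auto
    next
      case False
      then have "(\<Sum>i\<in>closed_nbhd G j - ?B. pmf p i) < \<gamma> / 3"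
        using level_pos_iff[OF stage_pos, of j j] level_stage[of j] j Union_level by auto
      then show ?thesis
        using le False by auto
    qed
  qed
  let ?P0 = "\<Sum>i\<in>level 0. pmf p i" and ?P1 = "\<Sum>i\<in>?H. pmf p i"
  have "2 * \<gamma> / 3 * ?P1 \<le> (\<Sum>i\<in>?H. pmf p i * (\<Sum>j\<in>frozen_arms. pmf p j * ?e i j))"
    unfolding sum_distrib_left
    by (subst mult.commute, intro sum_mono, simp only: sum_distrib_left[symmetric])
      (intro mult_left_mono lower, auto)
  also have "\<dots> = (\<Sum>j\<in>frozen_arms. pmf p j * (\<Sum>i\<in>?H. pmf p i * ?e i j))"
    unfolding sum_distrib_left by (subst sum.swap) (simp add: mult_ac)
  also have "\<dots> \<le> (\<Sum>j\<in>frozen_arms. pmf p j * (if j \<in> level 0 then \<gamma> else \<gamma> / 3))"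
    by (intro sum_mono mult_left_mono upper) auto
  also have "\<dots> = (\<Sum>j\<in>level 0. pmf p j * \<gamma>) + (\<Sum>j\<in>?H. pmf p j * (\<gamma> / 3))"
    by (subst sum.subset_diff[OF level_subset[of 0]]) (auto intro!: arg_cong2[of _ _ _ _ "(+)"] sum.cong)
  also have "\<dots> = \<gamma> * ?P0 + \<gamma> / 3 * ?P1"
    unfolding sum_distrib_left by (simp add: mult.commute)
  \<comment> \<open>Here 2\<gamma>/3 P1 \<le> \<gamma> P0 + \<gamma>/3 P1; the terms in P1 leave a
    positive remainder \<gamma>/3 P1 because the second threshold is small enough.\<close>
  finally have "\<gamma> * ?P1 \<le> \<gamma> * (3 * ?P0)"
    by (simp add: algebra_simps)
  then show ?thesis
    using gamma_pos by simp
qed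

lemma frozen_mass: "(\<Sum>i\<in>frozen_arms. pmf p i) \<le> \<epsilon>"
proof -
  have "(\<Sum>i\<in>frozen_arms. pmf p i) \<le> 4 * (\<Sum>i\<in>level 0. pmf p i)"
    using positive_level_mass sum.subset_diff[OF level_subset[of 0] finite, of "pmf p"] by simp
  also have "\<dots> \<le> 4 * (\<alpha> * \<gamma>)"
    using level_0_mass by simp
  also have "\<dots> = \<epsilon>"
    using alpha_pos by (simp add: threshold_def)
  finally show ?thesis .
qed

lemma weight_nonneg: "0 \<le> weight i"
  using frozen_mass eps_less_1 by (auto simp: dtf_weight_def)

lemma weight_le_1: "weight i \<le> 1"
proof (cases "i \<in> frozen_arms")
  case False
  have "pmf p i + (\<Sum>j\<in>frozen_arms. pmf p j) = (\<Sum>j\<in>insert i frozen_arms. pmf p j)"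
    using False by simp
  also have "\<dots> \<le> (\<Sum>j\<in>UNIV. pmf p j)"
    by (intro sum_mono2) auto
  also have "\<dots> = 1"
    by (simp add: sum_pmf_eq_1)
  finally show ?thesis
    using frozen_mass eps_less_1 by (auto simp: dtf_weight_def divide_simps)
qed (simp add: dtf_weight_def)

text \<open>Renormalisation divides by a number in (0, 1], so it only increases the mass of unfrozen
  arms, and the bound for \<open>p\<close> carries over.\<close>

lemma unfrozen_observation_weight:
  assumes "i \<notin> frozen_arms"
  shows "\<gamma> / 3 \<le> (\<Sum>j\<in>closed_nbhd G i. weight j)"
proof -
  let ?q = "1 - (\<Sum>j\<in>frozen_arms. pmf p j)"
  have q: "0 < ?q" "?q \<le> 1"
    using frozen_mass eps_less_1 by (auto intro: sum_nonneg)
  have "\<gamma> / 3 \<le> (\<Sum>j\<in>closed_nbhd G i - frozen_arms. pmf p j)"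
    by (rule unfrozen_nbhd_mass[OF assms])
  also have "\<dots> \<le> (\<Sum>j\<in>closed_nbhd G i - frozen_arms. weight j)"
    using q by (intro sum_mono) (auto simp: dtf_weight_def divide_simps mult_left_le)
  also have "\<dots> \<le> (\<Sum>j\<in>closed_nbhd G i. weight j)"
    by (intro sum_mono2) (auto simp: weight_nonneg)
  finally show ?thesis .
qed

text \<open>Only unfrozen arms get a nonzero estimate, and their denominators are at least
  \<gamma>/3. The upper end is the L for which the guarantee of the full information algorithm is
  invoked.\<close>

lemma dtf_estimate_range:
  assumes "\<And>i. l i \<in> {0..1}"
  shows "dtf_estimate \<alpha> \<epsilon> G (pmf p) l a i \<in> {0..3 / \<gamma>}"
proof (cases "i \<in> closed_nbhd G a - frozen_arms")
  case True
  let ?W = "\<Sum>j\<in>closed_nbhd G i. weight j"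
  have W: "\<gamma> / 3 \<le> ?W"
    using True by (intro unfrozen_observation_weight) auto
  have "l i / ?W \<le> 1 / (\<gamma> / 3)"
    using W assms[of i] gamma_pos by (intro frac_le) auto
  then show ?thesis
    using True W assms[of i] gamma_pos by (auto simp: dtf_estimate_def)
next
  case False
  then show ?thesis
    using gamma_pos by (auto simp: dtf_estimate_def)
qed

end

section \<open>A measurable surrogate for the regret of one round\<close>

text \<open>\<open>dtf_estimate\<close> with the test for being unfrozen replaced by
  \<open>c \<le> W\<close>. For c = \<gamma>/3 all unfrozen arms pass, so the two differ at most on
  frozen arms, where this one can be positive.\<close>

definition truncated_estimate ::
  "real \<Rightarrow> 'arm::finite rel \<Rightarrow> ('arm \<Rightarrow> real) \<Rightarrow> ('arm \<Rightarrow> real) \<Rightarrow> 'arm \<Rightarrow> 'arm \<Rightarrow> real" where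
  "truncated_estimate c G v l a i =
     (let W = \<Sum>j\<in>closed_nbhd G i. v j
      in if i \<in> closed_nbhd G a \<and> c \<le> W then l i / W else 0)"

text \<open>
  Lower bound for the regret of the full information algorithm in one round that depends on the
  distribution \<open>v\<close> of the drawn arm \<open>a\<close> only. The distribution of the full information algorithm
  and the frozen arms need not be measurable functions of the past, hence do not occur.
\<close>

definition surrogate_regret ::
  "real \<Rightarrow> real \<Rightarrow> 'arm::finite rel \<Rightarrow> ('arm \<Rightarrow> real) \<Rightarrow> ('arm \<Rightarrow> real) \<Rightarrow> 'arm \<Rightarrow> 'arm \<Rightarrow> real" where
  "surrogate_regret c \<epsilon> G v l f a =
     (1 - \<epsilon>)\<^sup>2 * (\<Sum>i\<in>UNIV. v i * truncated_estimate c G v l a i) - truncated_estimate c G v l a f"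

lemma truncated_estimate_range:
  assumes "0 < c" "\<And>i. l i \<in> {0..1}"
  shows "truncated_estimate c G v l a i \<in> {0..1 / c}"
proof -
  have "l i / W \<in> {0..1 / c}" if "c \<le> W" for W
    using assms(1) assms(2)[of i] that by (auto intro!: frac_le)
  then show ?thesis
    using assms(1) by (auto simp: truncated_estimate_def Let_def)
qed

lemma abs_surrogate_regret_le:
  fixes G :: "'arm::finite rel"
  assumes "0 < c" "\<And>i. l i \<in> {0..1}" "\<And>i. v i \<in> {0..1}"
  shows "\<bar>surrogate_regret c \<epsilon> G v l f a\<bar> \<le> (1 - \<epsilon>)\<^sup>2 * (CARD('arm) / c) + 1 / c"
proof -
  note range = truncated_estimate_range[of c l, OF assms(1,2)]
  have "\<bar>v i * truncated_estimate c G v l a i\<bar> \<le> 1 * (1 / c)" for i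
    unfolding abs_mult using range[of G v a i] assms(3)[of i] by (intro mult_mono) auto
  then have "\<bar>\<Sum>i\<in>UNIV. v i * truncated_estimate c G v l a i\<bar> \<le> (\<Sum>i\<in>(UNIV::'arm set). 1 * (1 / c))"
    by (rule order.trans[OF sum_abs sum_mono])
  also have "\<dots> = CARD('arm) / c"
    by simp
  finally have "\<bar>(1 - \<epsilon>)\<^sup>2 * (\<Sum>i\<in>UNIV. v i * truncated_estimate c G v l a i)\<bar> \<le>
      (1 - \<epsilon>)\<^sup>2 * (CARD('arm) / c)"
    unfolding abs_mult by (simp add: mult_left_mono del: times_divide_eq_right)
  moreover have "\<bar>truncated_estimate c G v l a f\<bar> \<le> 1 / c"
    using range[of G v a f] by auto
  ultimately show ?thesis
    unfolding surrogate_regret_def by linarith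
qed

context freezing_round
begin

text \<open>One factor \<open>1 - \<epsilon>\<close> is that of the approximate regret; the other
  bounds from below the unfrozen mass \<open>?q\<close>, which converts \<open>weight\<close> into
  \<open>pmf p\<close>. Replacing the estimate at \<open>f\<close> by the larger truncated one only
  lowers the surrogate.\<close>

lemma surrogate_regret_le:
  fixes l :: "'arm \<Rightarrow> real" and a f :: 'arm
  assumes "\<And>i. l i \<in> {0..1}"
  defines "e \<equiv> dtf_estimate \<alpha> \<epsilon> G (pmf p) l a"
  shows "surrogate_regret (\<gamma> / 3) \<epsilon> G weight l f a \<le>
    (1 - \<epsilon>) * (\<Sum>i\<in>UNIV. pmf p i * e i) - e f"
proof -
  let ?q = "1 - (\<Sum>j\<in>frozen_arms. pmf p j)"
  let ?e' = "truncated_estimate (\<gamma> / 3) G weight l a"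
  have q: "1 - \<epsilon> \<le> ?q"
    using frozen_mass by simp
  have e'_nonneg: "0 \<le> ?e' i" for i
    using truncated_estimate_range[of "\<gamma> / 3" l G weight a i] assms(1) gamma_pos by auto
  have e: "e i = (if i \<in> frozen_arms then 0 else ?e' i)" for i
    using unfrozen_observation_weight[of i]
    by (auto simp: e_def dtf_estimate_def truncated_estimate_def Let_def)
  have "pmf p i * e i = ?q * (weight i * ?e' i)" for i
    using q eps_less_1 by (auto simp: e dtf_weight_def)
  then have "(\<Sum>i\<in>UNIV. pmf p i * e i) = ?q * (\<Sum>i\<in>UNIV. weight i * ?e' i)"
    by (simp add: sum_distrib_left)
  moreover have "(1 - \<epsilon>) * (\<Sum>i\<in>UNIV. weight i * ?e' i) \<le> ?q * (\<Sum>i\<in>UNIV. weight i * ?e' i)"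
    using q by (intro mult_right_mono sum_nonneg mult_nonneg_nonneg weight_nonneg e'_nonneg) auto
  ultimately have "(1 - \<epsilon>) * ((1 - \<epsilon>) * (\<Sum>i\<in>UNIV. weight i * ?e' i)) \<le>
      (1 - \<epsilon>) * (\<Sum>i\<in>UNIV. pmf p i * e i)"
    using eps_less_1 by (intro mult_left_mono) auto
  moreover have "e f \<le> ?e' f"
    using e'_nonneg by (simp add: e)
  ultimately show ?thesis
    unfolding surrogate_regret_def by (simp add: power2_eq_square mult.assoc)
qed

lemma mean_surrogate_regret_ge:
  assumes l: "\<And>i. l i \<in> {0..1}"
  shows "(1 - 2 * \<epsilon>) * (\<Sum>i\<in>UNIV. weight i * l i) - l f \<le>
    (\<Sum>a\<in>UNIV. weight a * surrogate_regret (\<gamma> / 3) \<epsilon> G weight l f a)"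
proof -
  let ?e' = "truncated_estimate (\<gamma> / 3) G weight l"
  let ?W = "\<lambda>i. \<Sum>j\<in>closed_nbhd G i. weight j"
  \<comment> \<open>By symmetry, \<open>i\<close> is observed exactly when the drawn arm lies in its
    neighbourhood, which has probability \<open>?W i\<close> and cancels the denominator.\<close>
  have mean: "(\<Sum>a\<in>UNIV. weight a * ?e' a i) = (if \<gamma> / 3 \<le> ?W i then l i else 0)" for i
  proof (cases "\<gamma> / 3 \<le> ?W i")
    case True
    have "(\<Sum>a\<in>UNIV. weight a * ?e' a i) = (\<Sum>a\<in>closed_nbhd G i. weight a * (l i / ?W i))"
      using True undirected_graph_closed_nbhd_sym[OF undirected]
      by (intro sum.mono_neutral_cong_right) (auto simp: truncated_estimate_def Let_def)
    also have "\<dots> = ?W i * (l i / ?W i)"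
      by (simp only: sum_distrib_right)
    also have "\<dots> = l i"
      using True gamma_pos by auto
    finally show ?thesis
      using True by simp
  qed (auto simp: truncated_estimate_def Let_def)
  \<comment> \<open>A frozen arm has weight 0, and an unfrozen one passes the truncation test, so
    truncation causes no bias under \<open>weight\<close>.\<close>
  have *: "weight i * (\<Sum>a\<in>UNIV. weight a * ?e' a i) = weight i * l i" for i
    using mean unfrozen_observation_weight[of i] by (auto simp: dtf_weight_def)
  have "(\<Sum>a\<in>UNIV. weight a * (\<Sum>i\<in>UNIV. weight i * ?e' a i)) =
      (\<Sum>i\<in>UNIV. weight i * (\<Sum>a\<in>UNIV. weight a * ?e' a i))"
    unfolding sum_distrib_left by (subst sum.swap) (simp add: mult_ac)
  also have "\<dots> = (\<Sum>i\<in>UNIV. weight i * l i)"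
    by (simp only: *)
  finally have swap: "(\<Sum>a\<in>UNIV. weight a * (\<Sum>i\<in>UNIV. weight i * ?e' a i)) =
      (\<Sum>i\<in>UNIV. weight i * l i)" .
  have "(\<Sum>a\<in>UNIV. weight a * surrogate_regret (\<gamma> / 3) \<epsilon> G weight l f a) =
      (1 - \<epsilon>)\<^sup>2 * (\<Sum>a\<in>UNIV. weight a * (\<Sum>i\<in>UNIV. weight i * ?e' a i)) -
      (\<Sum>a\<in>UNIV. weight a * ?e' a f)"
    unfolding surrogate_regret_def right_diff_distrib sum_subtractf
    by (subst (2) sum_distrib_left) (simp add: mult_ac)
  also have "\<dots> = (1 - \<epsilon>)\<^sup>2 * (\<Sum>i\<in>UNIV. weight i * l i) - (\<Sum>a\<in>UNIV. weight a * ?e' a f)"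
    unfolding swap ..
  \<comment> \<open>(1 - \<epsilon>) squared is at least 1 - 2\<epsilon>, and at \<open>f\<close>
    truncation can only decrease the mean.\<close>
  also have "\<dots> \<ge> (1 - 2 * \<epsilon>) * (\<Sum>i\<in>UNIV. weight i * l i) - l f"
    using l by (intro diff_mono mult_right_mono sum_nonneg mult_nonneg_nonneg weight_nonneg)
      (auto simp: mean power2_eq_square algebra_simps)
  finally show ?thesis .
qed

end

section \<open>Averaging over the draw, and measurability\<close>

text \<open>Split \<open>X \<omega> (I t \<omega>)\<close> over the events \<open>I t = a\<close>
  and pull the \<open>F t\<close>-measurable factor out of each conditional expectation. The weights
  are the conditional probabilities themselves, which are measurable even where the weights of the
  learner are not.\<close>

lemma (in graph_feedback_protocol) draw_expectation:
  fixes X :: "'\<omega> \<Rightarrow> 'arm \<Rightarrow> real"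
  assumes t: "t \<in> {1..T}"
    and meas: "\<And>a. (\<lambda>\<omega>. X \<omega> a) \<in> borel_measurable (F t)"
    and bound: "AE \<omega> in M. \<forall>a. \<bar>X \<omega> a\<bar> \<le> B"
  defines "v \<equiv> \<lambda>\<omega> a. real_cond_exp M (F t) (indicator {\<omega> \<in> space M. I t \<omega> = a}) \<omega>"
  shows "integrable M (\<lambda>\<omega>. X \<omega> (I t \<omega>))"
    and "integrable M (\<lambda>\<omega>. \<Sum>a\<in>UNIV. v \<omega> a * X \<omega> a)"
    and "expectation (\<lambda>\<omega>. X \<omega> (I t \<omega>)) = expectation (\<lambda>\<omega>. \<Sum>a\<in>UNIV. v \<omega> a * X \<omega> a)"
proof -
  interpret finite_measure_subalgebra M "F t"
    by unfold_locales (rule subalg)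
  let ?S = "\<lambda>a. {\<omega> \<in> space M. I t \<omega> = a}"
  have measM: "(\<lambda>\<omega>. X \<omega> a) \<in> borel_measurable M" for a
    using measurable_from_subalg[OF subalg meas] .
  have S: "?S a \<in> sets M" for a
    using measurable_sets[OF draw_measurable[OF t], of "{a}"] by (simp add: vimage_def Int_def conj_commute)
  then have ind: "(indicator (?S a) :: _ \<Rightarrow> real) \<in> borel_measurable M" for a
    by simp
  have eq: "X \<omega> (I t \<omega>) = (\<Sum>a\<in>UNIV. X \<omega> a * indicator (?S a) \<omega>)" if "\<omega> \<in> space M" for \<omega>
    using that by (simp add: indicator_def sum.delta')
  have int: "integrable M (\<lambda>\<omega>. X \<omega> a * indicator (?S a) \<omega>)" for a
  proof (rule integrable_const_bound)
    show "AE \<omega> in M. norm (X \<omega> a * indicator (?S a) \<omega>) \<le> \<bar>B\<bar>"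
      using bound
    proof eventually_elim
      case (elim \<omega>)
      then have "\<bar>X \<omega> a\<bar> \<le> \<bar>B\<bar>"
        by (meson abs_ge_self order.trans)
      then show ?case
        by (auto simp: indicator_def)
    qed
  qed (use measM ind in measurable)
  note cond = real_cond_exp_intg[OF int meas ind]
  show "integrable M (\<lambda>\<omega>. X \<omega> (I t \<omega>))"
    using int by (simp only: Bochner_Integration.integrable_cong[OF refl eq])
      (rule Bochner_Integration.integrable_sum)
  show "integrable M (\<lambda>\<omega>. \<Sum>a\<in>UNIV. v \<omega> a * X \<omega> a)"
    using cond(1) unfolding v_def
    by (subst mult.commute) (rule Bochner_Integration.integrable_sum)
  show "expectation (\<lambda>\<omega>. X \<omega> (I t \<omega>)) = expectation (\<lambda>\<omega>. \<Sum>a\<in>UNIV. v \<omega> a * X \<omega> a)"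
    by (simp only: Bochner_Integration.integral_cong[OF refl eq] v_def int cond
        Bochner_Integration.integral_sum mult.commute[of "real_cond_exp _ _ _ _"])
qed

lemma borel_measurable_surrogate_regret:
  fixes G :: "'\<omega> \<Rightarrow> 'arm::finite rel"
  assumes G: "G \<in> N \<rightarrow>\<^sub>M count_space UNIV"
    and v [measurable]: "\<And>i. (\<lambda>\<omega>. v \<omega> i) \<in> borel_measurable N"
    and l [measurable]: "\<And>i. (\<lambda>\<omega>. l \<omega> i) \<in> borel_measurable N"
  shows "(\<lambda>\<omega>. surrogate_regret c \<epsilon> (G \<omega>) (v \<omega>) (l \<omega>) f a) \<in> borel_measurable N"
proof -
  have mem [measurable]: "Measurable.pred N (\<lambda>\<omega>. i \<in> closed_nbhd (G \<omega>) j)" for i j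
    using measurable_compose[OF G, of "\<lambda>g. i \<in> closed_nbhd g j" "count_space UNIV"] by simp
  \<comment> \<open>The index set depends on \<omega>; summing over all arms moves this dependence
    into a measurable condition.\<close>
  have sum: "(\<Sum>j\<in>closed_nbhd (G \<omega>) i. v \<omega> j) =
      (\<Sum>j\<in>UNIV. if j \<in> closed_nbhd (G \<omega>) i then v \<omega> j else 0)" for \<omega> i
    by (simp add: sum.inter_filter[symmetric])
  have [measurable]: "(\<lambda>\<omega>. truncated_estimate c (G \<omega>) (v \<omega>) (l \<omega>) a i) \<in> borel_measurable N" for i
    unfolding truncated_estimate_def Let_def sum by measurable
  show ?thesis
    unfolding surrogate_regret_def by measurable
qed

section \<open>From the pathwise guarantee to the expected regret\<close>

theorem theorem3p1:
  fixes M :: "'\<omega> measure" and F :: "nat \<Rightarrow> '\<omega> measure"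
    and T :: nat
    and G :: "nat \<Rightarrow> '\<omega> \<Rightarrow> 'arm::finite rel"
    and l :: "nat \<Rightarrow> '\<omega> \<Rightarrow> 'arm \<Rightarrow> real"
    and I :: "nat \<Rightarrow> '\<omega> \<Rightarrow> 'arm"
    and \<A> :: "'arm full_info_alg"
    and A :: "nat \<Rightarrow> nat \<Rightarrow> real"
    and \<alpha> \<epsilon> :: real
    and f :: 'arm
  assumes "0 < \<epsilon>" and "\<epsilon> < 1"
    and "1 \<le> T"
    and "0 \<le> A CARD('arm) T"
    and "\<And>L ls g. 0 < L \<Longrightarrow> (\<And>t i. t \<in> {1..T} \<Longrightarrow> ls t i \<in> {0..L}) \<Longrightarrow>
           full_info_apx_regret \<A> T ls g (\<epsilon> / 2) \<le> 2 * L * A CARD('arm) T / \<epsilon>"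
    and "graph_feedback_protocol M F T G
           (\<lambda>t \<omega>. dtf_play \<A> \<alpha> (\<epsilon> / 2) (\<lambda>s. G s \<omega>) (\<lambda>s. l s \<omega>) (\<lambda>s. I s \<omega>) t) l I"
    and "\<And>t \<omega>. t \<in> {1..T} \<Longrightarrow> \<omega> \<in> space M \<Longrightarrow> real (independence_number (G t \<omega>)) \<le> \<alpha>"
  shows "prob_space.expectation M
           (\<lambda>\<omega>. apx_regret T (\<lambda>t. l t \<omega> (I t \<omega>)) (\<lambda>t. l t \<omega>) f \<epsilon>)
         \<le> 48 * \<alpha> * A CARD('arm) T / \<epsilon>\<^sup>2"
proof -
  define p where "p t \<omega> = dtf_full_info \<A> \<alpha> (\<epsilon> / 2) (\<lambda>s. G s \<omega>) (\<lambda>s. l s \<omega>) (\<lambda>s. I s \<omega>) t" for t \<omega>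
  define w where "w t \<omega> = dtf_weight \<alpha> (\<epsilon> / 2) (G t \<omega>) (pmf (p t \<omega>))" for t \<omega>
  interpret graph_feedback_protocol M F T G w l I
    using assms(6) unfolding w_def [abs_def] p_def dtf_play_def .
  \<comment> \<open>A measurable version of \<open>w\<close>, equal to it almost everywhere.\<close>
  define v where "v t \<omega> i = real_cond_exp M (F t) (indicator {\<omega> \<in> space M. I t \<omega> = i}) \<omega>" for t \<omega> i
  define c where "c = threshold \<alpha> (\<epsilon> / 2) / 3"
  define D where "D t \<omega> = surrogate_regret c (\<epsilon> / 2) (G t \<omega>) (v t \<omega>) (l t \<omega>) f" for t \<omega>
  define B where "B = 48 * \<alpha> * A CARD('arm) T / \<epsilon>\<^sup>2"
  have round: "freezing_round \<alpha> (\<epsilon> / 2) (G t \<omega>)" if "t \<in> {1..T}" "\<omega> \<in> space M" for t \<omega>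
    using that assms graph by unfold_locales auto
  obtain \<omega>\<^sub>0 where "\<omega>\<^sub>0 \<in> space M"
    using not_empty by auto
  then have \<alpha>: "0 < \<alpha>" and c: "0 < c"
    using freezing_round.alpha_pos[OF round] freezing_round.gamma_pos[OF round] \<open>1 \<le> T\<close>
    by (auto simp: c_def)
  have v: "AE \<omega> in M. v t \<omega> = w t \<omega>" if "t \<in> {1..T}" for t
    using AE_finite_allI[OF finite[of UNIV] draw_distribution[OF that]]
    by (simp add: v_def fun_eq_iff)
  have l_range: "l t \<omega> i \<in> {0..1}" if "t \<in> {1..T}" "\<omega> \<in> space M" for t \<omega> i
    using loss that by blast
  have D_meas: "(\<lambda>\<omega>. D t \<omega> a) \<in> borel_measurable (F t)" if "t \<in> {1..T}" for t a
    unfolding D_def v_def using that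
    by (intro borel_measurable_surrogate_regret graph_measurable loss_measurable) auto
  have D_bound: "AE \<omega> in M. \<forall>a. \<bar>D t \<omega> a\<bar> \<le> (1 - \<epsilon> / 2)\<^sup>2 * (CARD('arm) / c) + 1 / c"
    if t: "t \<in> {1..T}" for t
    using v[OF t] AE_space
  proof eventually_elim
    case (elim \<omega>)
    interpret R: freezing_round \<alpha> "\<epsilon> / 2" "G t \<omega>" "p t \<omega>"
      using round t elim(2) .
    show ?case
      unfolding D_def using l_range[OF t elim(2)] R.weight_nonneg R.weight_le_1 elim(1)
      by (intro allI abs_surrogate_regret_le c) (auto simp: w_def)
  qed
  note D_draw = draw_expectation[OF _ D_meas D_bound, folded v_def]
  have l_bound: "AE \<omega> in M. \<forall>i. \<bar>l t \<omega> i\<bar> \<le> 1" if "t \<in> {1..T}" for t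
    using l_range[OF that] by (intro AE_I2) auto
  note l_draw = draw_expectation[OF _ loss_measurable l_bound, folded v_def]
  have l_int: "integrable M (\<lambda>\<omega>. l t \<omega> f)" if t: "t \<in> {1..T}" for t
  proof (rule integrable_const_bound)
    show "AE \<omega> in M. norm (l t \<omega> f) \<le> 1"
      using l_bound[OF t] by auto
    show "(\<lambda>\<omega>. l t \<omega> f) \<in> borel_measurable M"
      using measurable_from_subalg[OF subalg loss_measurable[OF t]] .
  qed
  \<comment> \<open>Both sides are averaged over the draw given \<open>F t\<close>; the comparison
    then holds for almost every \<omega> by \<open>mean_surrogate_regret_ge\<close>.\<close>
  have step: "expectation (\<lambda>\<omega>. (1 - \<epsilon>) * l t \<omega> (I t \<omega>) - l t \<omega> f) \<le> expectation (\<lambda>\<omega>. D t \<omega> (I t \<omega>))"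
    if t: "t \<in> {1..T}" for t
  proof -
    have "expectation (\<lambda>\<omega>. (1 - \<epsilon>) * l t \<omega> (I t \<omega>) - l t \<omega> f) =
        expectation (\<lambda>\<omega>. (1 - \<epsilon>) * (\<Sum>a\<in>UNIV. v t \<omega> a * l t \<omega> a) - l t \<omega> f)"
      using l_draw[OF t t t] l_int[OF t] by simp
    also have "\<dots> \<le> expectation (\<lambda>\<omega>. \<Sum>a\<in>UNIV. v t \<omega> a * D t \<omega> a)"
    proof (rule integral_mono_AE)
      show "AE \<omega> in M. (1 - \<epsilon>) * (\<Sum>a\<in>UNIV. v t \<omega> a * l t \<omega> a) - l t \<omega> f
          \<le> (\<Sum>a\<in>UNIV. v t \<omega> a * D t \<omega> a)"
        using v[OF t] AE_space
      proof eventually_elim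
        case (elim \<omega>)
        interpret R: freezing_round \<alpha> "\<epsilon> / 2" "G t \<omega>" "p t \<omega>"
          using round t elim(2) .
        show ?case
          \<comment> \<open>The round is analysed at \<epsilon>/2, so the factor
            \<open>1 - 2 * \<epsilon>\<close> there is \<open>1 - \<epsilon>\<close> here.\<close>
          using R.mean_surrogate_regret_ge[of "l t \<omega>" f, OF l_range[OF t elim(2)]]
          unfolding D_def elim(1) w_def c_def by simp
      qed
    qed (use l_draw[OF t t t] l_int[OF t] D_draw[OF t t t] in auto)
    also have "\<dots> = expectation (\<lambda>\<omega>. D t \<omega> (I t \<omega>))"
      using D_draw(3)[OF t t t] by simp
    finally show ?thesis .
  qed
  \<comment> \<open>Along a fixed outcome the estimates are one fixed loss sequence in [0, 1/c], so
    the guarantee for arbitrary sequences applies pathwise, even though the estimates arise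
    adaptively.\<close>
  have D_le: "AE \<omega> in M. (\<Sum>t=1..T. D t \<omega> (I t \<omega>)) \<le> B"
  proof -
    have "AE \<omega> in M. \<forall>t\<in>{1..T}. v t \<omega> = w t \<omega>"
      using v by (intro AE_finite_allI) auto
    then show ?thesis
      using AE_space
    proof eventually_elim
      case (elim \<omega>)
      define ls where "ls = dtf_loss \<A> \<alpha> (\<epsilon> / 2) (\<lambda>s. G s \<omega>) (\<lambda>s. l s \<omega>) (\<lambda>s. I s \<omega>)"
      have p: "p t \<omega> = \<A> (map ls [1..<t])" for t
        by (simp add: p_def dtf_full_info_def ls_def)
      have ls: "ls t = dtf_estimate \<alpha> (\<epsilon> / 2) (G t \<omega>) (pmf (p t \<omega>)) (l t \<omega>) (I t \<omega>)" for t
        unfolding p ls_def by (rule ext, subst dtf_loss.simps) simp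
      have D: "D t \<omega> (I t \<omega>) \<le> (1 - \<epsilon> / 2) * (\<Sum>i\<in>UNIV. pmf (p t \<omega>) i * ls t i) - ls t f"
        and range: "ls t i \<in> {0..1 / c}" if t: "t \<in> {1..T}" for t i
      proof -
        interpret R: freezing_round \<alpha> "\<epsilon> / 2" "G t \<omega>" "p t \<omega>"
          using round t elim(2) .
        show "D t \<omega> (I t \<omega>) \<le> (1 - \<epsilon> / 2) * (\<Sum>i\<in>UNIV. pmf (p t \<omega>) i * ls t i) - ls t f"
          using R.surrogate_regret_le[of "l t \<omega>" f, OF l_range[OF t elim(2)]] elim(1) t
          by (simp add: D_def ls w_def c_def)
        show "ls t i \<in> {0..1 / c}"
          using R.dtf_estimate_range[of "l t \<omega>", OF l_range[OF t elim(2)]]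
          by (simp add: ls c_def)
      qed
      have "(\<Sum>t=1..T. D t \<omega> (I t \<omega>)) \<le> full_info_apx_regret \<A> T ls f (\<epsilon> / 2)"
        unfolding full_info_apx_regret_def apx_regret_def p[symmetric] sum_distrib_left
          sum_subtractf[symmetric]
        using D by (intro sum_mono) (simp add: sum_distrib_left)
      also have "\<dots> \<le> 2 * (1 / c) * A CARD('arm) T / \<epsilon>"
        using c range by (intro assms(5)) auto
      \<comment> \<open>With learning parameter \<epsilon>/2, the constant \<open>1 / c\<close>
        equals 24\<alpha>/\<epsilon>.\<close>
      also have "\<dots> = B"
        using \<alpha> \<open>0 < \<epsilon>\<close> by (simp add: B_def c_def threshold_def field_simps power2_eq_square)
      finally show ?case .
    qed
  qed
  have "expectation (\<lambda>\<omega>. apx_regret T (\<lambda>t. l t \<omega> (I t \<omega>)) (\<lambda>t. l t \<omega>) f \<epsilon>) =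
      (\<Sum>t=1..T. expectation (\<lambda>\<omega>. (1 - \<epsilon>) * l t \<omega> (I t \<omega>) - l t \<omega> f))"
    unfolding apx_regret_def sum_distrib_left sum_subtractf[symmetric]
    using l_draw(1) l_int by (intro Bochner_Integration.integral_sum) auto
  also have "\<dots> \<le> (\<Sum>t=1..T. expectation (\<lambda>\<omega>. D t \<omega> (I t \<omega>)))"
    by (intro sum_mono step)
  also have "\<dots> = expectation (\<lambda>\<omega>. \<Sum>t=1..T. D t \<omega> (I t \<omega>))"
    using D_draw(1) by (intro Bochner_Integration.integral_sum[symmetric]) auto
  also have "\<dots> \<le> expectation (\<lambda>\<omega>. B)"
    using D_draw(1) D_le by (intro integral_mono_AE) auto
  also have "\<dots> = B"
    by (simp add: prob_space)
  finally show ?thesis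
    unfolding B_def .
qed

end
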